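(* The hypergraph $\mathsf H_{21}$ (defined in the context) has no faithful orthogonal representation in $\mathbb R^3$.
   Context: Inner product: $\langle x,y\rangle=\sum_{k}\overline{x_k}\,y_k$ (over $\mathbb R$, the standard dot product). Faithful orthogonal representation: let $\mathsf H=(V,\mathcal E)$ be a three-uniform hypergraph, $\mathbb F\in\{\mathbb R,\mathbb C\}$ and $d\ge 3$. A faithful orthogonal representation of $\mathsf H$ in $\mathbb F^d$ assigns to every $v\in V$ a nonzero vector $x_v\in\mathbb F^d$ such that (1) distinct vertices determine distinct rays (one-dimensional subspaces), and (2) for distinct $u,v\in V$, $\langle x_u,x_v\rangle=0$ if and only if $u$ and $v$ belong to a common hyperedge. The hypergraph $\mathsf H_{21}$: it has 21 vertices, namely $v_0,\ldots,v_7$ (midpoints), $v_{01},v_{12},v_{23},v_{34},v_{45},v_{56},v_{67},v_{70}$ (corners; also written $v_{j,j+1}$ with indices modulo $8$), $a_1,a_2,b_1,b_2$, and $c$. It has 14 hyperedges: $E_j=\{v_{j-1,j},\,v_j,\,v_{j,j+1}\}$ for $j=0,\ldots,7$ (indices modulo $8$); $D_0=\{v_0,a_1,v_4\}$, $D_2=\{v_2,a_2,v_6\}$, $D_1=\{v_1,b_2,v_5\}$, $D_3=\{v_3,b_1,v_7\}$; $F_a=\{a_1,c,a_2\}$, $F_b=\{b_1,c,b_2\}$. *)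

theory Defs
  imports "HOL-Analysis.Analysis"
begin

definition three_uniform_hypergraph :: "'v set \<Rightarrow> 'v set set \<Rightarrow> bool" where
  "three_uniform_hypergraph V E \<longleftrightarrow> (\<forall>e\<in>E. e \<subseteq> V \<and> card e = 3)"

definition faithful_orthogonal_representation ::
  "'v set \<Rightarrow> 'v set set \<Rightarrow> ('v \<Rightarrow> real ^ 'd) \<Rightarrow> bool" where
  "faithful_orthogonal_representation V E x \<longleftrightarrow>
     (\<forall>v\<in>V. x v \<noteq> 0) \<and>
     (\<forall>u\<in>V. \<forall>v\<in>V. u \<noteq> v \<longrightarrow> span {x u} \<noteq> span {x v}) \<and>
     (\<forall>u\<in>V. \<forall>v\<in>V. u \<noteq> v \<longrightarrow> (x u \<bullet> x v = 0 \<longleftrightarrow> (\<exists>e\<in>E. u \<in> e \<and> v \<in> e)))"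

text \<open>
  The index type \<open>8\<close> is the ring of integers modulo 8, so index arithmetic wraps around.
  \<open>Mid j\<close> is the midpoint $v_j$ and \<open>Corner j\<close> is the corner $v_{j,j+1}$; in particular
  \<open>Corner 7\<close> is $v_{70}$ and \<open>Corner (j - 1)\<close> is $v_{j-1,j}$.
\<close>

datatype vertex = Mid 8 | Corner 8 | A1 | A2 | B1 | B2 | C

definition H21_vertices :: "vertex set" where
  "H21_vertices = UNIV"

definition H21_edges :: "vertex set set" where
  "H21_edges =
     range (\<lambda>j. {Corner (j - 1), Mid j, Corner j}) \<union>
     {{Mid 0, A1, Mid 4}, {Mid 2, A2, Mid 6}, {Mid 1, B2, Mid 5}, {Mid 3, B1, Mid 7},
      {A1, C, A2}, {B1, C, B2}}"

lemma H21_vertices_eq: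
  "H21_vertices = range Mid \<union> range Corner \<union> {A1, A2, B1, B2, C}"
  unfolding H21_vertices_def
proof (intro set_eqI iffI)
  fix v :: vertex
  show "v \<in> range Mid \<union> range Corner \<union> {A1, A2, B1, B2, C}"
    by (cases v) auto
qed simp

lemma card_H21_vertices: "card H21_vertices = 21"
proof -
  have M: "card (range Mid) = 8" "card (range Corner) = 8"
    by (simp_all add: card_image inj_on_def)
  have "card (range Mid \<union> range Corner) = 16"
    by (subst card_Un_disjoint) (auto simp: M)
  then show ?thesis
    unfolding H21_vertices_eq by (subst card_Un_disjoint) auto
qed

lemma card_H21_edges: "card H21_edges = 14"
proof -
  let ?f = "\<lambda>j::8. {Corner (j - 1), Mid j, Corner j}"
  have "inj ?f" by (auto simp: inj_on_def)
  then have "card (range ?f) = 8" by (simp add: card_image)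
  moreover have "card {{Mid 0, A1, Mid 4}, {Mid 2, A2, Mid 6}, {Mid 1, B2, Mid 5},
      {Mid 3, B1, Mid 7}, {A1, C, A2}, {B1, C, B2}} = 6"
    by (simp add: card_insert_if set_eq_subset)
  ultimately show ?thesis
    unfolding H21_edges_def by (subst card_Un_disjoint) auto
qed

lemma three_uniform_H21: "three_uniform_hypergraph H21_vertices H21_edges"
  unfolding three_uniform_hypergraph_def
  by (auto simp: H21_edges_def H21_vertices_def)

end

theory Submission
  imports Defs
begin

text \<open>
  Scale all vectors to unit length. Parseval's identity in the orthonormal frame of $E_j$ gives
  $\langle v_{j-1},v_j\rangle\langle v_j,v_{j+1}\rangle = \langle v_{j-1},v_{j+1}\rangle$, and only
  $j=1$ and $j=5$ are needed. In coordinates with respect to $a_1,a_2,c$ one has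
  $v_0=(0,p,q)$, $v_2=(r,0,s)$, $b_1=(k,l,0)$ and $v_1=t\,b_1+z\,c$, while up to sign
  $v_4=(0,-q,p)$, $v_6=(-s,0,r)$ and $v_5=-z\,b_1+t\,c$. After cancelling $t$ and $z$, the two
  identities become linear in $(t,z)$; eliminating $t$ and $z$ leaves $pq\cdot rs\cdot kl=1$,
  which is impossible since each of the three products has modulus at most $1/2$.
\<close>

lemma orthonormal_basis_expand_3:
  fixes e1 e2 e3 u v :: "real ^ 3"
  assumes "norm e1 = 1" "norm e2 = 1" "norm e3 = 1"
    and "e1 \<bullet> e2 = 0" "e1 \<bullet> e3 = 0" "e2 \<bullet> e3 = 0"
  shows "u \<bullet> v = (u \<bullet> e1) * (v \<bullet> e1) + (u \<bullet> e2) * (v \<bullet> e2) + (u \<bullet> e3) * (v \<bullet> e3)"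
proof -
  let ?B = "{e1, e2, e3}"
  have sq: "e1 \<bullet> e1 = 1" "e2 \<bullet> e2 = 1" "e3 \<bullet> e3 = 1"
    using assms(1-3) by (simp_all add: norm_eq_1)
  then have distinct: "e1 \<noteq> e2" "e1 \<noteq> e3" "e2 \<noteq> e3"
    using assms(4-6) by auto
  have orth: "pairwise orthogonal ?B"
    using assms(4-6) by (auto simp: pairwise_def orthogonal_def inner_commute)
  have "0 \<notin> ?B"
    using assms(1-3) by auto
  with orth have "independent ?B"
    by (rule pairwise_orthogonal_independent)
  moreover have "card ?B = DIM(real ^ 3)"
    using distinct by simp
  ultimately have "span ?B = UNIV"
    using card_eq_dim[of ?B UNIV] by auto
  then have "(\<Sum>e\<in>?B. (v \<bullet> e) *\<^sub>R e) = v"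
    using assms(1-3) by (intro orthonormal_basis_expand[OF orth]) auto
  then have "u \<bullet> v = u \<bullet> (\<Sum>e\<in>?B. (v \<bullet> e) *\<^sub>R e)"
    by simp
  then show ?thesis
    using distinct by (simp add: inner_add_right)
qed

text \<open>A unit vector perpendicular to (p, q) is its quarter turn up to sign, and the
  determinant of the two vectors is that sign, so it serves as the witness.\<close>

lemma orthonormal_pair_in_plane:
  fixes p q p' q' :: real
  assumes "p\<^sup>2 + q\<^sup>2 = 1" "p'\<^sup>2 + q'\<^sup>2 = 1" "p * p' + q * q' = 0"
  obtains \<epsilon> where "\<epsilon>\<^sup>2 = 1" "p' = - \<epsilon> * q" "q' = \<epsilon> * p"
proof
  show "(p * q' - q * p')\<^sup>2 = 1" using assms by algebra
  show "p' = - (p * q' - q * p') * q" using assms by algebra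
  show "q' = (p * q' - q * p') * p" using assms by algebra
qed

lemma abs_mult_le_half:
  fixes p q :: real
  assumes "p\<^sup>2 + q\<^sup>2 = 1"
  shows "\<bar>p * q\<bar> \<le> 1 / 2"
  using assms sum_squares_bound[of "\<bar>p\<bar>" "\<bar>q\<bar>"] by (simp add: abs_mult)

text \<open>Unprimed letters are coordinates of $v_0$, $v_2$, $v_1$, primed ones of the opposite
  midpoints $v_4$, $v_6$, $v_5$; \<open>k\<close>, \<open>l\<close> belong to $b_1$. The two factors
  in \<open>eq1\<close> are the inner products of $v_1$ with $v_0$ and $v_2$.\<close>

lemma octagon_identities_inconsistent:
  fixes k l p q r s t z p' q' r' s' t' z' :: real
  assumes kl: "k\<^sup>2 + l\<^sup>2 = 1"
    and pq: "p\<^sup>2 + q\<^sup>2 = 1" "p'\<^sup>2 + q'\<^sup>2 = 1" "p * p' + q * q' = 0"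
    and rs: "r\<^sup>2 + s\<^sup>2 = 1" "r'\<^sup>2 + s'\<^sup>2 = 1" "r * r' + s * s' = 0"
    and tz: "t\<^sup>2 + z\<^sup>2 = 1" "t'\<^sup>2 + z'\<^sup>2 = 1" "t * t' + z * z' = 0"
    and nz: "k \<noteq> 0" "l \<noteq> 0" "z \<noteq> 0" "z' \<noteq> 0"
    and eq1: "(p * l * t + q * z) * (r * k * t + s * z) = q * s"
    and eq5: "(p' * l * t' + q' * z') * (r' * k * t' + s' * z') = q' * s'"
  shows False
proof -
  obtain x where x: "x\<^sup>2 = 1" "p' = - x * q" "q' = x * p"
    using pq by (rule orthonormal_pair_in_plane)
  obtain y where y: "y\<^sup>2 = 1" "r' = - y * s" "s' = y * r"
    using rs by (rule orthonormal_pair_in_plane)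
  obtain w where w: "w\<^sup>2 = 1" "t' = - w * z" "z' = w * t"
    using tz by (rule orthonormal_pair_in_plane)
  have "t \<noteq> 0" using nz w by auto
  \<comment> \<open>Each factor of \<open>eq5\<close> contributes one \<open>w\<close>, and both
    sides carry \<open>x * y\<close>, so the unknown signs drop out.\<close>
  have "x * y * w\<^sup>2 * ((q * l * z + p * t) * (s * k * z + r * t)) = x * y * (p * r)"
    using eq5 unfolding x(2,3) y(2,3) w(2,3) by algebra
  moreover have "x \<noteq> 0" "y \<noteq> 0" using x(1) y(1) by auto
  ultimately have eq5': "(q * l * z + p * t) * (s * k * z + r * t) = p * r"
    using w(1) by (simp add: mult.assoc)
  \<comment> \<open>Writing \<open>q * s\<close> as q s (t^2 + z^2) makes \<open>eq1\<close>
    homogeneous in (t, z). The z^2 terms cancel and a factor \<open>t\<close> splits off; in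
    \<open>eq5'\<close> it is the t^2 terms that cancel, leaving a factor \<open>z\<close>.\<close>
  have "t * (z * (q * r * k + p * s * l)) = t * (t * (q * s - p * r * k * l))"
    using eq1 tz(1) by algebra
  then have lin1: "z * (q * r * k + p * s * l) = t * (q * s - p * r * k * l)"
    using \<open>t \<noteq> 0\<close> by simp
  have "z * (t * (p * s * k + q * r * l)) = z * (z * (p * r - q * s * k * l))"
    using eq5' tz(1) by algebra
  then have lin5: "t * (p * s * k + q * r * l) = z * (p * r - q * s * k * l)"
    using \<open>z \<noteq> 0\<close> by simp
  have "t * z * ((q * s - p * r * k * l) * (p * r - q * s * k * l)) =
        t * z * ((q * r * k + p * s * l) * (p * s * k + q * r * l))"
    using lin1 lin5 by algebra
  then have "(q * s - p * r * k * l) * (p * r - q * s * k * l) =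
        (q * r * k + p * s * l) * (p * s * k + q * r * l)"
    using \<open>t \<noteq> 0\<close> \<open>z \<noteq> 0\<close> by simp
  \<comment> \<open>Since k^2 + l^2 = 1, the term p q r s cancels from both expansions, and the four
    remaining squares on the right assemble into the product of sums.\<close>
  then have "(k * l) * ((p * q) * (r * s) * (k * l)) = (k * l) * ((p\<^sup>2 + q\<^sup>2) * (r\<^sup>2 + s\<^sup>2))"
    using kl by algebra
  then have "(p * q) * (r * s) * (k * l) = 1"
    using nz pq(1) rs(1) by simp
  then have "\<bar>p * q\<bar> * \<bar>r * s\<bar> * \<bar>k * l\<bar> = 1"
    by (metis abs_mult abs_one)
  moreover have "\<bar>p * q\<bar> * \<bar>r * s\<bar> * \<bar>k * l\<bar> \<le> (1 / 2) * (1 / 2) * (1 / 2)"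
    using abs_mult_le_half[OF pq(1)] abs_mult_le_half[OF rs(1)] abs_mult_le_half[OF kl]
    by (intro mult_mono) auto
  ultimately show False by simp
qed

theorem theorem7:
  shows "\<not> (\<exists>x :: vertex \<Rightarrow> real ^ 3.
           faithful_orthogonal_representation H21_vertices H21_edges x)"
proof
  assume "\<exists>x :: vertex \<Rightarrow> real ^ 3.
           faithful_orthogonal_representation H21_vertices H21_edges x"
  then obtain x :: "vertex \<Rightarrow> real ^ 3"
    where rep: "faithful_orthogonal_representation H21_vertices H21_edges x" ..
  define n where "n v = sgn (x v)" for v
  have nonzero: "x v \<noteq> 0" for v
    using rep by (simp add: faithful_orthogonal_representation_def H21_vertices_def)
  have unit: "norm (n v) = 1" for v
    using nonzero by (simp add: n_def norm_sgn)
  have perp_iff: "n u \<bullet> n v = 0 \<longleftrightarrow> (\<exists>e\<in>H21_edges. u \<in> e \<and> v \<in> e)" if "u \<noteq> v" for u v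
    using rep that nonzero
    by (simp add: faithful_orthogonal_representation_def H21_vertices_def n_def sgn_div_norm)
  have perp: "n u \<bullet> n v = 0" if "e \<in> H21_edges" "u \<in> e" "v \<in> e" "u \<noteq> v" for e u v
    using perp_iff that by blast
  have parseval: "y \<bullet> y' = (y \<bullet> n u) * (y' \<bullet> n u) + (y \<bullet> n v) * (y' \<bullet> n v) + (y \<bullet> n w) * (y' \<bullet> n w)"
    if "{u, v, w} \<in> H21_edges" "u \<noteq> v" "u \<noteq> w" "v \<noteq> w" for y y' u v w
    using that by (intro orthonormal_basis_expand_3 unit perp[of "{u, v, w}"]) auto
  have E: "{Corner (j - 1), Mid j, Corner j} \<in> H21_edges" for j
    by (auto simp: H21_edges_def)
  have D: "{Mid 0, A1, Mid 4} \<in> H21_edges" "{Mid 2, A2, Mid 6} \<in> H21_edges"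
    "{Mid 1, B2, Mid 5} \<in> H21_edges"
    and Fa: "{A1, A2, C} \<in> H21_edges" and Fb: "{B1, B2, C} \<in> H21_edges"
    by (auto simp: H21_edges_def insert_commute)

  have perps:
    "n (Mid 0) \<bullet> n A1 = 0" "n (Mid 4) \<bullet> n A1 = 0" "n (Mid 0) \<bullet> n (Mid 4) = 0"
    "n (Mid 2) \<bullet> n A2 = 0" "n (Mid 6) \<bullet> n A2 = 0" "n (Mid 2) \<bullet> n (Mid 6) = 0"
    "n (Mid 1) \<bullet> n B2 = 0" "n (Mid 5) \<bullet> n B2 = 0" "n (Mid 1) \<bullet> n (Mid 5) = 0"
    "n B1 \<bullet> n C = 0"
    using D Fb by (auto intro: perp)
  \<comment> \<open>Faithfulness in the other direction: none of these pairs lies in a common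
    hyperedge.\<close>
  have nz: "n B1 \<bullet> n A1 \<noteq> 0" "n B1 \<bullet> n A2 \<noteq> 0" "n (Mid 1) \<bullet> n C \<noteq> 0" "n (Mid 5) \<bullet> n C \<noteq> 0"
    by (subst perp_iff; auto simp: H21_edges_def)+
  \<comment> \<open>In the frame of $E_j$, each neighbouring midpoint is orthogonal to the corner it
    shares with $E_j$, so only the middle term of Parseval survives.\<close>
  have octagon: "(n (Mid (j - 1)) \<bullet> n (Mid j)) * (n (Mid (j + 1)) \<bullet> n (Mid j)) =
      n (Mid (j - 1)) \<bullet> n (Mid (j + 1))" for j
  proof -
    have "n (Mid (j - 1)) \<bullet> n (Corner (j - 1)) = 0"
      using E[of "j - 1"] by (auto intro: perp)
    moreover have "n (Mid (j + 1)) \<bullet> n (Corner j) = 0"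
      using E[of "j + 1"] by (auto intro: perp)
    ultimately show ?thesis
      using parseval[OF E[of j], of "n (Mid (j - 1))" "n (Mid (j + 1))"] by simp
  qed
  note a_frame = parseval[OF Fa, simplified]
  note b_frame = parseval[OF Fb, simplified]
  have sq: "n v \<bullet> n v = 1" for v
    using unit by (simp add: norm_eq_1)
  \<comment> \<open>This moves products with $v_1$ or $v_5$ to the axes $b_1$ and $c$. As $c$ lies
    in both frames, only the $b_1$ coordinate must be translated to $a_1, a_2$.\<close>
  have b_expand: "n (Mid i) \<bullet> n (Mid j) =
      (n (Mid i) \<bullet> n B1) * (n (Mid j) \<bullet> n B1) + (n (Mid i) \<bullet> n C) * (n (Mid j) \<bullet> n C)"
    if "n (Mid j) \<bullet> n B2 = 0" for i j
    using that b_frame[of "n (Mid i)" "n (Mid j)"] by simp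
  have B1_expand: "n v \<bullet> n B1 = (n v \<bullet> n A1) * (n B1 \<bullet> n A1) + (n v \<bullet> n A2) * (n B1 \<bullet> n A2)" for v
    using a_frame[of "n v" "n B1"] perps by simp
  show False
  proof (rule octagon_identities_inconsistent)
    show "(n B1 \<bullet> n A1)\<^sup>2 + (n B1 \<bullet> n A2)\<^sup>2 = 1"
      using a_frame[of "n B1" "n B1"] perps sq by (simp add: power2_eq_square)
    show "(n (Mid 0) \<bullet> n A2)\<^sup>2 + (n (Mid 0) \<bullet> n C)\<^sup>2 = 1"
      "(n (Mid 4) \<bullet> n A2)\<^sup>2 + (n (Mid 4) \<bullet> n C)\<^sup>2 = 1"
      "(n (Mid 2) \<bullet> n A1)\<^sup>2 + (n (Mid 2) \<bullet> n C)\<^sup>2 = 1"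
      "(n (Mid 6) \<bullet> n A1)\<^sup>2 + (n (Mid 6) \<bullet> n C)\<^sup>2 = 1"
      using a_frame[of "n (Mid 0)" "n (Mid 0)"] a_frame[of "n (Mid 4)" "n (Mid 4)"]
        a_frame[of "n (Mid 2)" "n (Mid 2)"] a_frame[of "n (Mid 6)" "n (Mid 6)"] perps sq
      by (simp_all add: power2_eq_square)
    show "(n (Mid 0) \<bullet> n A2) * (n (Mid 4) \<bullet> n A2) + (n (Mid 0) \<bullet> n C) * (n (Mid 4) \<bullet> n C) = 0"
      "(n (Mid 2) \<bullet> n A1) * (n (Mid 6) \<bullet> n A1) + (n (Mid 2) \<bullet> n C) * (n (Mid 6) \<bullet> n C) = 0"
      using a_frame[of "n (Mid 0)" "n (Mid 4)"] a_frame[of "n (Mid 2)" "n (Mid 6)"] perps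
      by simp_all
    show "(n (Mid 1) \<bullet> n B1)\<^sup>2 + (n (Mid 1) \<bullet> n C)\<^sup>2 = 1"
      "(n (Mid 5) \<bullet> n B1)\<^sup>2 + (n (Mid 5) \<bullet> n C)\<^sup>2 = 1"
      "(n (Mid 1) \<bullet> n B1) * (n (Mid 5) \<bullet> n B1) + (n (Mid 1) \<bullet> n C) * (n (Mid 5) \<bullet> n C) = 0"
      using b_expand[of 1 1] b_expand[of 5 5] b_expand[of 5 1] perps sq by (simp_all add: power2_eq_square)
    \<comment> \<open>$v_0$ has no $a_1$ coordinate and $v_2$ no $a_2$ coordinate, so each has a
      single term in its product with $b_1$, and their product with each other reduces to the $c$
      term.\<close>
    show "((n (Mid 0) \<bullet> n A2) * (n B1 \<bullet> n A2) * (n (Mid 1) \<bullet> n B1) +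
          (n (Mid 0) \<bullet> n C) * (n (Mid 1) \<bullet> n C)) *
        ((n (Mid 2) \<bullet> n A1) * (n B1 \<bullet> n A1) * (n (Mid 1) \<bullet> n B1) +
          (n (Mid 2) \<bullet> n C) * (n (Mid 1) \<bullet> n C)) =
        (n (Mid 0) \<bullet> n C) * (n (Mid 2) \<bullet> n C)"
      using octagon[of 1] b_expand[of 1 0] b_expand[of 1 2] B1_expand[of "Mid 0"] B1_expand[of "Mid 2"]
        a_frame[of "n (Mid 0)" "n (Mid 2)"] perps by simp
    show "((n (Mid 4) \<bullet> n A2) * (n B1 \<bullet> n A2) * (n (Mid 5) \<bullet> n B1) +
          (n (Mid 4) \<bullet> n C) * (n (Mid 5) \<bullet> n C)) *
        ((n (Mid 6) \<bullet> n A1) * (n B1 \<bullet> n A1) * (n (Mid 5) \<bullet> n B1) +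
          (n (Mid 6) \<bullet> n C) * (n (Mid 5) \<bullet> n C)) =
        (n (Mid 4) \<bullet> n C) * (n (Mid 6) \<bullet> n C)"
      using octagon[of 5] b_expand[of 5 4] b_expand[of 5 6] B1_expand[of "Mid 4"] B1_expand[of "Mid 6"]
        a_frame[of "n (Mid 4)" "n (Mid 6)"] perps by simp
  qed (use nz in auto)
qed

end
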